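(* Let $\mathbb{F}$ be an algebraically closed field of characteristic $0$ and let $L$ be a finite-dimensional Lie algebra over $\mathbb{F}$ with a basis $\{e_1,e_2,\dots,e_s\}$. Then $L$ is nilpotent if and only if $$p_{\mathrm{ad}}(z_0,z_1,\dots,z_s)=z_0^{\,s},$$ where $p_{\mathrm{ad}}(z_0,z_1,\dots,z_s)=\det\big(z_0I+\sum_{i=1}^s z_i\,\mathrm{ad}_{e_i}\big)\in\mathbb{F}[z_0,z_1,\dots,z_s]$.
   Context: Here $\mathrm{ad}_x:L\to L$, $\mathrm{ad}_x(y)=[x,y]$, is the adjoint representation and $I$ is the identity on $L$; the determinant is that of the $s\times s$ matrix of the operator in a basis of $L$, with $z_0,\dots,z_s$ indeterminates. *)

theory Defs
  imports Complex_Main "HOL-Library.Poly_Mapping" "Jordan_Normal_Form.Determinant"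
begin

text \<open>
  Multivariate polynomials over a commutative ring, in indeterminates indexed by the natural
  numbers: finitely supported maps from monomials (finitely supported exponent vectors) to
  coefficients, with the convolution product of \<^theory>\<open>HOL-Library.Poly_Mapping\<close>. The ring
  $F[z_0,\ldots,z_s]$ is the subring in which only the indeterminates of index at most $s$ occur.
\<close>

type_synonym 'a mpoly = "(nat \<Rightarrow>\<^sub>0 nat) \<Rightarrow>\<^sub>0 'a"

definition indet :: "nat \<Rightarrow> 'a::comm_ring_1 mpoly" where
  "indet i = Poly_Mapping.single (Poly_Mapping.single i 1) 1"

definition const_mpoly :: "'a::comm_ring_1 \<Rightarrow> 'a mpoly" where
  "const_mpoly c = Poly_Mapping.single 0 c"

locale lie_algebra = vector_space scale
  for scale :: "'a::field \<Rightarrow> 'b::ab_group_add \<Rightarrow> 'b" (infixr \<open>*s\<close> 75) +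
  fixes bracket :: "'b \<Rightarrow> 'b \<Rightarrow> 'b"
  assumes bracket_add_left: "bracket (x + y) z = bracket x z + bracket y z"
    and bracket_add_right: "bracket x (y + z) = bracket x y + bracket x z"
    and bracket_scale_left: "bracket (c *s x) y = c *s bracket x y"
    and bracket_scale_right: "bracket x (c *s y) = c *s bracket x y"
    and bracket_self: "bracket x x = 0"
    and jacobi: "bracket x (bracket y z) + bracket y (bracket z x) + bracket z (bracket x y) = 0"
begin

definition ad :: "'b \<Rightarrow> 'b \<Rightarrow> 'b" where
  "ad x y = bracket x y"

primrec lower_central_series :: "nat \<Rightarrow> 'b set" where
  "lower_central_series 0 = UNIV"
| "lower_central_series (Suc k) = span {bracket x y | x y. y \<in> lower_central_series k}"

definition nilpotent :: bool where
  "nilpotent \<longleftrightarrow> (\<exists>k. lower_central_series k = {0})"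

text \<open>A basis is the family $e_1,\ldots,e_s$; values of \<open>e\<close> outside \<open>{1..s}\<close> are irrelevant.\<close>

definition is_basis :: "nat \<Rightarrow> (nat \<Rightarrow> 'b) \<Rightarrow> bool" where
  "is_basis s e \<longleftrightarrow> inj_on e {1..s} \<and> independent (e ` {1..s}) \<and> span (e ` {1..s}) = UNIV"

text \<open>
  Column \<open>l\<close> holds the coordinates of the image of the \<open>l\<close>-th basis vector. Rows and columns of
  \<^typ>\<open>'a mat\<close> are numbered from 0, whence the shift by \<^const>\<open>Suc\<close>.
\<close>

definition matrix_of :: "nat \<Rightarrow> (nat \<Rightarrow> 'b) \<Rightarrow> ('b \<Rightarrow> 'b) \<Rightarrow> 'a mat" where
  "matrix_of s e T =
     mat s s (\<lambda>(k, l). representation (e ` {1..s}) (T (e (Suc l))) (e (Suc k)))"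

definition p_ad :: "nat \<Rightarrow> (nat \<Rightarrow> 'b) \<Rightarrow> 'a mpoly" where
  "p_ad s e = det (mat s s (\<lambda>(k, l).
     indet 0 * const_mpoly (matrix_of s e id $$ (k, l)) +
     (\<Sum>i = 1..s. indet i * const_mpoly (matrix_of s e (ad (e i)) $$ (k, l)))))"

end

end

theory Submission
  imports Defs "Jordan_Normal_Form.Char_Poly"
begin

text \<open>
  Write \<open>A x\<close> for the matrix of \<open>ad x\<close>. Evaluating \<open>p_ad\<close> at a point \<open>(c, v\<^sub>1, \<dots>, v\<^sub>s)\<close> gives
  \<open>det (c I + A y)\<close> with \<open>y = v\<^sub>1 e\<^sub>1 + \<dots> + v\<^sub>s e\<^sub>s\<close>, and as \<open>A\<close> is linear this is the characteristic
  polynomial of \<open>A (- y)\<close> at \<open>c\<close> (\<open>eval_p_ad\<close>). The sign is harmless, because \<open>- y\<close> runs through all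
  of \<open>L\<close>. Over a field of characteristic 0 a polynomial is determined by its values
  (\<open>eval_mpoly_inject\<close>), so the equation \<open>p_ad = z\<^sub>0\<^sup>s\<close> says that every \<open>A x\<close> has characteristic
  polynomial \<open>X\<^sup>s\<close>.

  If \<open>L\<close> is nilpotent, some power of each \<open>ad x\<close> vanishes, so 0 is the only eigenvalue of \<open>A x\<close>;
  over an algebraically closed field this forces the characteristic polynomial to be \<open>X\<^sup>s\<close>
  (\<open>char_poly_eq_monom_if_eigenvalues_zero\<close>). Conversely, if the characteristic polynomial is
  \<open>X\<^sup>s\<close>, then \<open>(A x)\<^sup>s = 0\<close> by the Cayley-Hamilton theorem, of which only this case is proved
  (\<open>char_poly_monom_imp_nilpotent\<close>). So every \<open>ad x\<close> is nilpotent, and Engel's theorem (\<open>engel\<close>)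
  makes \<open>L\<close> nilpotent.

  Engel's theorem is usually proved by letting subalgebras act on quotient spaces. Here a quotient
  \<open>W / U\<close> is represented by the pair of invariant subspaces \<open>U \<subset> W\<close> of \<open>L\<close>, and a vector of the
  quotient that the subalgebra \<open>K\<close> kills by some \<open>w \<in> W - U\<close> with \<open>[K, w] \<subseteq> U\<close>
  (\<open>engel_common_vector\<close>). All spaces involved then lie inside \<open>L\<close>.
\<close>

section \<open>Evaluation of multivariate polynomials\<close>

definition eval_monomial :: "(nat \<Rightarrow> 'a::comm_ring_1) \<Rightarrow> (nat \<Rightarrow>\<^sub>0 nat) \<Rightarrow> 'a" where
  "eval_monomial v m = (\<Prod>i\<in>Poly_Mapping.keys m. v i ^ Poly_Mapping.lookup m i)"

definition eval_mpoly :: "(nat \<Rightarrow> 'a::comm_ring_1) \<Rightarrow> 'a mpoly \<Rightarrow> 'a" where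
  "eval_mpoly v p = (\<Sum>m\<in>Poly_Mapping.keys p. Poly_Mapping.lookup p m * eval_monomial v m)"

lemma eval_monomial_superset:
  assumes "finite S" "Poly_Mapping.keys m \<subseteq> S"
  shows "eval_monomial v m = (\<Prod>i\<in>S. v i ^ Poly_Mapping.lookup m i)"
  unfolding eval_monomial_def
  by (rule prod.mono_neutral_left) (use assms in \<open>auto simp: in_keys_iff\<close>)

lemma eval_monomial_zero [simp]: "eval_monomial v 0 = 1"
  by (simp add: eval_monomial_def)

lemma eval_monomial_add: "eval_monomial v (m + n) = eval_monomial v m * eval_monomial v n"
proof -
  let ?S = "Poly_Mapping.keys m \<union> Poly_Mapping.keys n"
  have "eval_monomial v (m + n) = (\<Prod>i\<in>?S. v i ^ Poly_Mapping.lookup (m + n) i)"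
    by (rule eval_monomial_superset) (use Poly_Mapping.keys_add[of m n] in auto)
  also have "\<dots> = (\<Prod>i\<in>?S. v i ^ Poly_Mapping.lookup m i) * (\<Prod>i\<in>?S. v i ^ Poly_Mapping.lookup n i)"
    by (simp add: lookup_add power_add prod.distrib)
  also have "\<dots> = eval_monomial v m * eval_monomial v n"
    by (simp add: eval_monomial_superset[of ?S])
  finally show ?thesis .
qed

lemma eval_monomial_mult_point:
  "eval_monomial (\<lambda>i. v i * w i) m = eval_monomial v m * eval_monomial w m"
  by (simp add: eval_monomial_def power_mult_distrib prod.distrib)

lemma eval_monomial_one_point [simp]: "eval_monomial (\<lambda>i. 1) m = 1"
  by (simp add: eval_monomial_def)

text \<open>
  Such a point isolates one exponent of the monomial; when the powers of \<open>t\<close> are distinct, these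
  points therefore separate monomials.
\<close>

lemma eval_monomial_unit_point:
  "eval_monomial (\<lambda>j. if j = i then t else 1) m = t ^ Poly_Mapping.lookup m i"
proof -
  have "eval_monomial (\<lambda>j. if j = i then t else 1) m =
      (\<Prod>j\<in>insert i (Poly_Mapping.keys m). (if j = i then t else 1) ^ Poly_Mapping.lookup m j)"
    by (rule eval_monomial_superset) auto
  also have "\<dots> = (\<Prod>j\<in>insert i (Poly_Mapping.keys m). if j = i then t ^ Poly_Mapping.lookup m i else 1)"
    by (rule prod.cong) auto
  also have "\<dots> = t ^ Poly_Mapping.lookup m i"
    by simp
  finally show ?thesis .
qed

lemma eval_mpoly_zero [simp]: "eval_mpoly v 0 = 0"
  by (simp add: eval_mpoly_def)

lemma eval_mpoly_single [simp]: "eval_mpoly v (Poly_Mapping.single m c) = c * eval_monomial v m"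
  by (simp add: eval_mpoly_def)

lemma eval_mpoly_add: "eval_mpoly v (p + q) = eval_mpoly v p + eval_mpoly v q"
  unfolding eval_mpoly_def
  by (rule Poly_Mapping.setsum_keys_plus_distrib) (auto simp: algebra_simps)

lemma eval_mpoly_sum: "eval_mpoly v (\<Sum>i\<in>I. f i) = (\<Sum>i\<in>I. eval_mpoly v (f i))"
  by (induction I rule: infinite_finite_induct) (auto simp: eval_mpoly_add)

lemma poly_mapping_sum_single:
  fixes p :: "'k \<Rightarrow>\<^sub>0 'c::comm_monoid_add"
  shows "p = (\<Sum>m\<in>Poly_Mapping.keys p. Poly_Mapping.single m (Poly_Mapping.lookup p m))"
  by (rule poly_mapping_eqI) (auto simp: lookup_sum lookup_single when_def in_keys_iff)

lemma eval_mpoly_mult: "eval_mpoly v (p * q) = eval_mpoly v p * eval_mpoly v q"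
proof -
  let ?s = "\<lambda>p m. Poly_Mapping.single m (Poly_Mapping.lookup p m) :: 'a mpoly"
  have "p * q = (\<Sum>m\<in>Poly_Mapping.keys p. \<Sum>n\<in>Poly_Mapping.keys q. ?s p m * ?s q n)"
    unfolding sum_product[symmetric] poly_mapping_sum_single[symmetric] ..
  then have "eval_mpoly v (p * q) = (\<Sum>m\<in>Poly_Mapping.keys p. \<Sum>n\<in>Poly_Mapping.keys q.
      (Poly_Mapping.lookup p m * eval_monomial v m) * (Poly_Mapping.lookup q n * eval_monomial v n))"
    by (simp add: eval_mpoly_sum mult_single eval_monomial_add mult_ac)
  then show ?thesis
    by (simp add: eval_mpoly_def sum_product)
qed

lemma eval_mpoly_indet [simp]: "eval_mpoly v (indet i) = v i"
  by (simp add: indet_def eval_monomial_def)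

lemma eval_mpoly_const [simp]: "eval_mpoly v (const_mpoly c) = c"
  by (simp add: const_mpoly_def)

lemma eval_mpoly_hom: "comm_ring_hom (eval_mpoly v)"
proof
  show "eval_mpoly v 1 = 1"
    by (simp add: single_one[symmetric] del: single_one)
qed (simp_all add: eval_mpoly_add eval_mpoly_mult)

text \<open>
  This is Dedekind's independence of characters. Evaluation of a monomial is multiplicative in the
  point, so scaling the point by \<open>w\<close> multiplies each summand by a factor of its own. Subtracting a
  multiple of the given relation removes the summand of \<open>a\<close> and keeps that of \<open>m\<close> up to a nonzero
  factor, provided \<open>w\<close> separates \<open>a\<close> and \<open>m\<close>. The separating \<open>w\<close> has a single coordinate 2 and
  ones elsewhere; in characteristic 0 distinct powers of 2 differ.
\<close>

lemma eval_monomials_independent: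
  fixes c :: "(nat \<Rightarrow>\<^sub>0 nat) \<Rightarrow> 'a::field_char_0"
  assumes "finite S" "\<And>v. (\<Sum>m\<in>S. c m * eval_monomial v m) = 0" "m \<in> S"
  shows "c m = 0"
  using assms
proof (induction S arbitrary: c m rule: finite_induct)
  case empty
  then show ?case by simp
next
  case (insert a S)
  have others: "c m = 0" if "m \<in> S" for m
  proof -
    have "m \<noteq> a"
      using that insert.hyps by blast
    then obtain i where i: "Poly_Mapping.lookup m i \<noteq> Poly_Mapping.lookup a i"
      using poly_mapping_eqI[of m a] by blast
    define t where "t n = (2::'a) ^ Poly_Mapping.lookup n i" for n :: "nat \<Rightarrow>\<^sub>0 nat"
    have neq: "t m \<noteq> t a"
    proof
      assume "t m = t a"
      then have "of_nat (2 ^ Poly_Mapping.lookup m i) = (of_nat (2 ^ Poly_Mapping.lookup a i) :: 'a)"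
        by (simp add: t_def)
      then have "(2::nat) ^ Poly_Mapping.lookup m i = 2 ^ Poly_Mapping.lookup a i"
        by (simp only: of_nat_eq_iff)
      then show False
        using i by simp
    qed
    have "(\<Sum>n\<in>S. (c n * (t n - t a)) * eval_monomial v n) = 0" for v
    proof -
      let ?w = "\<lambda>j. if j = i then 2 else (1::'a)"
      have "(\<Sum>n\<in>S. (c n * (t n - t a)) * eval_monomial v n) =
          (\<Sum>n\<in>insert a S. (c n * (t n - t a)) * eval_monomial v n)"
        using insert.hyps by simp
      also have "\<dots> = (\<Sum>n\<in>insert a S. c n * eval_monomial (\<lambda>j. v j * ?w j) n) -
          t a * (\<Sum>n\<in>insert a S. c n * eval_monomial v n)"
        by (simp only: eval_monomial_mult_point eval_monomial_unit_point t_def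
            sum_distrib_left sum_subtractf[symmetric])
          (rule sum.cong, auto simp: algebra_simps)
      also have "\<dots> = 0"
        by (simp only: insert.prems(1)) simp
      finally show ?thesis .
    qed
    from insert.IH[OF this that] neq show ?thesis
      by simp
  qed
  have "c a = 0"
    using insert.prems(1)[of "\<lambda>_. 1"] insert.hyps others by simp
  with others insert.prems(2) show ?case
    by auto
qed

lemma eval_mpoly_inject:
  fixes p q :: "'a::field_char_0 mpoly"
  assumes "\<And>v. eval_mpoly v p = eval_mpoly v q"
  shows "p = q"
proof -
  have "Poly_Mapping.lookup (p - q) m = 0" for m
  proof (cases "m \<in> Poly_Mapping.keys (p - q)")
    case True
    have "eval_mpoly v (p - q) = 0" for v
      using assms[of v] eval_mpoly_add[of v "p - q" q] by simp
    then show ?thesis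
      using eval_monomials_independent[of "Poly_Mapping.keys (p - q)" "Poly_Mapping.lookup (p - q)" m]
        True by (simp add: eval_mpoly_def)
  qed (simp add: in_keys_iff)
  then show ?thesis
    by (metis poly_mapping_eqI lookup_zero eq_iff_diff_eq_0)
qed

section \<open>Nilpotent matrices and characteristic polynomials\<close>

text \<open>
  The classical proof of Cayley-Hamilton: let \<open>C\<close> be the adjugate of \<open>X I - A\<close> and \<open>B k\<close> its
  \<open>k\<close>-th coefficient matrix. Comparing coefficients in \<open>(X I - A) C = X\<^sup>n I\<close> gives
  \<open>B (m - 1) - A B m = 0\<close>, or \<open>I\<close> when \<open>m = n\<close>, with \<open>B (- 1) = 0\<close>. Multiplied by \<open>A\<^sup>m\<close> these relations telescope, and
  since \<open>B m = 0\<close> for large \<open>m\<close>, only \<open>A\<^sup>n = 0\<close> is left.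
\<close>

lemma char_poly_monom_imp_nilpotent:
  fixes A :: "'a::comm_ring_1 mat"
  assumes A: "A \<in> carrier_mat n n" and cp: "char_poly A = monom 1 n"
  shows "A ^\<^sub>m n = 0\<^sub>m n n"
proof -
  define C where "C = adj_mat (char_poly_matrix A)"
  have cA: "char_poly_matrix A \<in> carrier_mat n n"
    using A by simp
  have C: "C \<in> carrier_mat n n" and CC: "char_poly_matrix A * C = monom 1 n \<cdot>\<^sub>m 1\<^sub>m n"
    using adj_mat[OF cA] cp by (auto simp: C_def char_poly_def)
  define B where "B k = map_mat (\<lambda>p. coeff p k) C" for k
  have B: "B k \<in> carrier_mat n n" for k
    using C by (simp add: B_def)
  have entry: "pCons 0 (C $$ (i, j)) = (\<Sum>k<n. smult (A $$ (i, k)) (C $$ (k, j)))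
      + (if i = j then monom 1 n else 0)" if ij: "i < n" "j < n" for i j
  proof -
    have "(char_poly_matrix A * C) $$ (i, j) =
        (\<Sum>k<n. ((if i = k then [:0, 1:] else 0) + [:- A $$ (i, k):]) * C $$ (k, j))"
      using ij A C
      by (auto simp: char_poly_matrix_def scalar_prod_def lessThan_atLeast0 intro!: sum.cong)
    also have "\<dots> = (\<Sum>k<n. (if i = k then [:0, 1:] * C $$ (k, j) else 0)) +
        (\<Sum>k<n. [:- A $$ (i, k):] * C $$ (k, j))"
      unfolding sum.distrib[symmetric] by (rule sum.cong) (auto simp: distrib_right)
    also have "\<dots> = pCons 0 (C $$ (i, j)) - (\<Sum>k<n. smult (A $$ (i, k)) (C $$ (k, j)))"
      using ij by (simp add: sum_negf)
    finally show ?thesis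
      using ij by (simp add: CC algebra_simps split: if_splits)
  qed
  have AB: "(A * B m) $$ (i, j) = (\<Sum>k<n. A $$ (i, k) * coeff (C $$ (k, j)) m)"
    if "i < n" "j < n" for i j m
    using that A C by (auto simp: B_def scalar_prod_def lessThan_atLeast0 intro!: sum.cong)
  have Bent: "B m $$ (i, j) = coeff (C $$ (i, j)) m" if "i < n" "j < n" for i j m
    using that C by (simp add: B_def)
  have B0: "A * B 0 = (if n = 0 then - 1\<^sub>m n else 0\<^sub>m n n)"
  proof (rule eq_matI)
    fix i j assume "i < dim_row (if n = 0 then - 1\<^sub>m n else (0\<^sub>m n n :: 'a mat))"
      "j < dim_col (if n = 0 then - 1\<^sub>m n else (0\<^sub>m n n :: 'a mat))"
    then have ij: "i < n" "j < n"
      by (auto split: if_splits)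
    show "(A * B 0) $$ (i, j) = (if n = 0 then - 1\<^sub>m n else 0\<^sub>m n n) $$ (i, j)"
      using ij arg_cong[OF entry[OF ij], of "\<lambda>p. coeff p 0"]
      by (auto simp: AB coeff_sum split: if_splits)
  qed (use A B in \<open>auto simp: B_def C_def\<close>)
  have BS: "A * B (Suc m) = B m - (if Suc m = n then 1\<^sub>m n else 0\<^sub>m n n)" for m
  proof (rule eq_matI)
    fix i j assume "i < dim_row (B m - (if Suc m = n then 1\<^sub>m n else 0\<^sub>m n n))"
      "j < dim_col (B m - (if Suc m = n then 1\<^sub>m n else 0\<^sub>m n n))"
    then have ij: "i < n" "j < n"
      by (auto split: if_splits)
    show "(A * B (Suc m)) $$ (i, j) =
        (B m - (if Suc m = n then 1\<^sub>m n else 0\<^sub>m n n)) $$ (i, j)"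
      using ij B[of m] Bent[OF ij] arg_cong[OF entry[OF ij], of "\<lambda>p. coeff p (Suc m)"]
      by (auto simp: AB coeff_sum simp del: sum.lessThan_Suc)
  qed (use A B in \<open>auto simp: B_def C_def\<close>)
  have pow: "A ^\<^sub>m k \<in> carrier_mat n n" for k
    using A by simp
  have tele: "A ^\<^sub>m Suc m * B m = (if n \<le> m then - (A ^\<^sub>m n) else 0\<^sub>m n n)" for m
  proof (induction m)
    case 0
    then show ?case
      using B0 A B by auto
  next
    case (Suc m)
    have "A ^\<^sub>m Suc (Suc m) * B (Suc m) = A ^\<^sub>m Suc m * (A * B (Suc m))"
      using A B[of "Suc m"] pow[of "Suc m"] by (simp add: assoc_mult_mat[of _ n n _ n _ n])
    also have "\<dots> = A ^\<^sub>m Suc m * B m - A ^\<^sub>m Suc m * (if Suc m = n then 1\<^sub>m n else 0\<^sub>m n n)"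
      unfolding BS by (rule mult_minus_distrib_mat[OF pow B]) auto
    also have "\<dots> = (if n \<le> Suc m then - (A ^\<^sub>m n) else 0\<^sub>m n n)"
      unfolding Suc.IH using A pow[of "Suc m"] by (auto simp: le_Suc_eq simp del: pow_mat.simps)
    finally show ?case .
  qed
  \<comment> \<open>\<open>N\<close> exceeds the degrees of all entries of \<open>C\<close> and is at least \<open>n\<close>, so that the telescoped
    relation at \<open>N\<close> has \<open>B N = 0\<close> on the left and \<open>- A\<^sup>n\<close> on the right.\<close>
  define N where "N = n + (\<Sum>i<n. \<Sum>j<n. Suc (degree (C $$ (i, j))))"
  have "B N = 0\<^sub>m n n"
  proof (rule eq_matI)
    fix i j assume "i < dim_row (0\<^sub>m n n :: 'a mat)" "j < dim_col (0\<^sub>m n n :: 'a mat)"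
    then have ij: "i < n" "j < n" by auto
    have "Suc (degree (C $$ (i, j))) \<le> (\<Sum>j<n. Suc (degree (C $$ (i, j))))"
      by (rule member_le_sum) (use ij in auto)
    also have "\<dots> \<le> (\<Sum>i<n. \<Sum>j<n. Suc (degree (C $$ (i, j))))"
      by (rule member_le_sum[of i "{..<n}" "\<lambda>i. \<Sum>j<n. Suc (degree (C $$ (i, j)))"]) (use ij in auto)
    finally have "degree (C $$ (i, j)) < N"
      by (simp add: N_def)
    then show "B N $$ (i, j) = 0\<^sub>m n n $$ (i, j)"
      using ij C by (simp add: B_def coeff_eq_0)
  qed (use C in \<open>auto simp: B_def\<close>)
  then have "0\<^sub>m n n = - (A ^\<^sub>m n)"
    using tele[of N] right_mult_zero_mat[OF pow[of "Suc N"], of n] by (simp add: N_def del: pow_mat.simps)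
  then have "A ^\<^sub>m n = - 0\<^sub>m n n"
    using pow[of n] by simp
  also have "- 0\<^sub>m n n = (0\<^sub>m n n :: 'a mat)"
    by (rule eq_matI) auto
  finally show ?thesis .
qed

lemma char_poly_eq_monom_if_eigenvalues_zero:
  fixes A :: "'a::alg_closed_field mat"
  assumes A: "A \<in> carrier_mat n n" and ev: "\<And>k. eigenvalue A k \<Longrightarrow> k = 0"
  shows "char_poly A = monom 1 n"
proof -
  let ?p = "char_poly A"
  have deg: "degree ?p = n" and lead: "lead_coeff ?p = 1"
    using degree_monic_char_poly[OF A] by auto
  then have "?p \<noteq> 0"
    by auto
  then obtain S where S: "size S = n" "?p = (\<Prod>x\<in>#S. [:-x, 1:])"
    using alg_closed_imp_factorization[of ?p] deg lead by auto
  have zero: "x = 0" if "x \<in># S" for x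
  proof (rule ev)
    have "poly ?p x = 0"
      using that by (auto simp: S(2) poly_prod_mset prod_mset_zero_iff)
    then show "eigenvalue A x"
      using eigenvalue_root_char_poly[OF A] by simp
  qed
  have "?p = (\<Prod>x\<in>#S. [:0, 1:])"
    unfolding S(2) by (rule arg_cong[of _ _ prod_mset], rule image_mset_cong) (simp add: zero)
  then show ?thesis
    by (simp add: S(1) monom_altdef)
qed

section \<open>Engel's theorem\<close>

context lie_algebra
begin

lemma bracket_zero_left [simp]: "bracket 0 x = 0"
  using bracket_scale_left[of 0 0 x] by simp

lemma bracket_zero_right [simp]: "bracket x 0 = 0"
  using bracket_scale_right[of x 0 0] by simp

lemma bracket_anticommute: "bracket x y = - bracket y x"
proof -
  have "0 = bracket (x + y) (x + y)"
    by (simp add: bracket_self)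
  also have "\<dots> = bracket x y + bracket y x"
    by (simp add: bracket_add_left bracket_add_right bracket_self[of x] bracket_self[of y])
  finally have "bracket x y + bracket y x = 0"
    by (rule sym)
  then show ?thesis
    by (simp only: eq_neg_iff_add_eq_0)
qed

lemma bracket_minus_right: "bracket x (- y) = - bracket x y"
  using bracket_add_right[of x y "- y"] by (simp add: eq_neg_iff_add_eq_0 add.commute)

lemma bracket_derivation: "bracket x (bracket y z) = bracket (bracket x y) z + bracket y (bracket x z)"
proof -
  have "bracket (bracket x y) z = - bracket z (bracket x y)"
    by (rule bracket_anticommute)
  moreover have "bracket y (bracket x z) = - bracket y (bracket z x)"
    by (simp only: bracket_anticommute[of x z] bracket_minus_right)
  moreover have "bracket x (bracket y z) = - (bracket y (bracket z x) + bracket z (bracket x y))"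
    using jacobi[of x y z] by (simp only: eq_neg_iff_add_eq_0 add.assoc)
  ultimately show ?thesis
    by simp
qed

definition subalgebra :: "'b set \<Rightarrow> bool" where
  "subalgebra K \<longleftrightarrow> subspace K \<and> (\<forall>x\<in>K. \<forall>y\<in>K. bracket x y \<in> K)"

definition invariant :: "'b set \<Rightarrow> 'b set \<Rightarrow> bool" where
  "invariant K U \<longleftrightarrow> (\<forall>x\<in>K. \<forall>u\<in>U. bracket x u \<in> U)"

lemma mem_span_insert_subspace:
  assumes "subspace H" and "x \<in> span (insert y H)"
  obtains h k where "h \<in> H" "x = h + k *s y"
proof -
  obtain k where "x - k *s y \<in> span H"
    using assms(2) span_breakdown_eq by blast
  then have "x - k *s y \<in> H"
    using assms(1) span_eq_iff by blast
  then show thesis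
    using that[of "x - k *s y" k] by simp
qed

text \<open>
  Even \<open>[H + F y, H + F y] \<subseteq> H\<close> holds, as \<open>y\<close> normalises \<open>H\<close> and \<open>[y, y] = 0\<close>.
\<close>

lemma subalgebra_span_insert:
  assumes H: "subalgebra H" and y: "\<And>h. h \<in> H \<Longrightarrow> bracket h y \<in> H"
  shows "subalgebra (span (insert y H))"
proof -
  have sH: "subspace H"
    using H by (simp add: subalgebra_def)
  have y': "bracket y h \<in> H" if "h \<in> H" for h
    using subspace_neg[OF sH y[OF that]] by (simp add: bracket_anticommute[of y h])
  have "bracket a b \<in> H" if a: "a \<in> span (insert y H)" and b: "b \<in> span (insert y H)" for a b
  proof -
    obtain h k where h: "h \<in> H" "a = h + k *s y"
      using mem_span_insert_subspace[OF sH a] .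
    obtain h' k' where h': "h' \<in> H" "b = h' + k' *s y"
      using mem_span_insert_subspace[OF sH b] .
    have "bracket a b = bracket h h' + k' *s bracket h y + k *s bracket y h'"
      by (simp add: h h' bracket_add_left bracket_add_right bracket_scale_left
          bracket_scale_right bracket_self algebra_simps)
    moreover have "bracket h h' \<in> H"
      using H h h' by (simp add: subalgebra_def)
    ultimately show ?thesis
      using sH y y' h h' by (simp add: subspace_add subspace_scale)
  qed
  moreover have "H \<subseteq> span (insert y H)"
    by (auto intro: span_base)
  ultimately show ?thesis
    by (auto simp: subalgebra_def)
qed

text \<open>
  The heart of Engel's theorem, by induction on \<open>dim K\<close>. For \<open>K \<noteq> 0\<close> take a proper subalgebra \<open>H\<close> of \<open>K\<close> of
  largest dimension. The induction hypothesis for \<open>H\<close> acting on the pair \<open>H \<subset> K\<close> yields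
  \<open>y \<in> K - H\<close> normalising \<open>H\<close>, so \<open>K = H + F y\<close> by the choice of \<open>H\<close>. Applied to the pair
  \<open>U \<subset> W\<close>, it shows that the space \<open>Z\<close> of all \<open>w \<in> W\<close> with \<open>[H, w] \<subseteq> U\<close> is not contained in \<open>U\<close>.
  As \<open>y\<close> normalises \<open>H\<close>, \<open>ad y\<close> preserves \<open>Z\<close>. Being nilpotent, it moves any element of
  \<open>Z - U\<close> into \<open>U\<close> after finitely many steps, and the last iterate outside \<open>U\<close> is the
  desired vector.
\<close>

lemma engel_common_vector:
  assumes fd: "finite_dimensional_vector_space scale B"
    and nil: "\<And>x y. \<exists>n. (ad x ^^ n) y = 0"
    and "subalgebra K" "subspace U" "subspace W" "invariant K U" "invariant K W" "U \<subset> W"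
  shows "\<exists>w\<in>W - U. \<forall>x\<in>K. bracket x w \<in> U"
  using assms(3-)
proof (induction "dim K" arbitrary: K U W rule: less_induct)
  case less
  interpret fd: finite_dimensional_vector_space scale B
    by (rule fd)
  note U = \<open>subspace U\<close> and W = \<open>subspace W\<close>
  have sK: "subspace K"
    using less.prems by (simp add: subalgebra_def)
  show ?case
  proof (cases "K = {0}")
    case True
    then show ?thesis
      using \<open>U \<subset> W\<close> subspace_0[OF U] by auto
  next
    case False
    let ?P = "\<lambda>H. subalgebra H \<and> H \<subset> K"
    have "?P {0}"
      using False subspace_0[OF sK] by (auto simp: subalgebra_def)
    moreover have "\<forall>H. ?P H \<longrightarrow> dim H < Suc (dim K)"
      by (auto intro!: le_imp_less_Suc fd.dim_subset)
    ultimately have "\<exists>H. ?P H \<and> (\<forall>H'. ?P H' \<longrightarrow> dim H' \<le> dim H)"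
      by (rule ex_has_greatest_nat)
    then obtain H where "?P H" and max: "\<And>H'. ?P H' \<Longrightarrow> dim H' \<le> dim H"
      by metis
    then have H: "subalgebra H" "H \<subset> K" and sH: "subspace H"
      by (auto simp: subalgebra_def)
    have dimH: "dim H < dim K"
      using fd.dim_psubset[of H K] H sH sK by (simp add: span_eq_iff[THEN iffD2])
    have invH: "invariant H H" "invariant H K" "invariant H U" "invariant H W"
      using H less.prems by (auto simp: subalgebra_def invariant_def)
    obtain y where y: "y \<in> K - H" "\<And>h. h \<in> H \<Longrightarrow> bracket h y \<in> H"
      using less.hyps[OF dimH H(1) sH sK invH(1,2) H(2)] by blast
    have KH: "span (insert y H) = K"
    proof (rule ccontr)
      assume neq: "span (insert y H) \<noteq> K"
      have "span (insert y H) \<subseteq> K"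
        using y H sK by (intro span_minimal) auto
      with neq have "dim (span (insert y H)) \<le> dim H"
        using max subalgebra_span_insert[OF H(1) y(2)] by blast
      moreover have "H \<subseteq> span (insert y H)"
        by (auto intro: span_base)
      ultimately have "H = span (insert y H)"
        using fd.subspace_dim_equal[OF sH subspace_span] by blast
      then show False
        using y(1) span_base[of y "insert y H"] by auto
    qed
    obtain w0 where w0: "w0 \<in> W - U" "\<And>h. h \<in> H \<Longrightarrow> bracket h w0 \<in> U"
      using less.hyps[OF dimH H(1) U W invH(3,4) \<open>U \<subset> W\<close>] by blast
    define Z where "Z = {w \<in> W. \<forall>h\<in>H. bracket h w \<in> U}"
    have yK: "y \<in> K"
      using y by simp
    have Zy: "bracket y w \<in> Z" if w: "w \<in> Z" for w
    proof -
      have "bracket h (bracket y w) \<in> U" if h: "h \<in> H" for h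
      proof -
        have "bracket (bracket h y) w \<in> U"
          using w y(2)[OF h] by (simp add: Z_def)
        moreover have "bracket y (bracket h w) \<in> U"
          using w h yK \<open>invariant K U\<close> by (simp add: Z_def invariant_def)
        ultimately show ?thesis
          by (simp add: bracket_derivation[of h y w] subspace_add[OF U])
      qed
      moreover have "bracket y w \<in> W"
        using w yK \<open>invariant K W\<close> by (simp add: Z_def invariant_def)
      ultimately show ?thesis
        by (simp add: Z_def)
    qed
    have Zpow: "(ad y ^^ n) w0 \<in> Z" for n
      by (induction n) (use w0 Zy in \<open>auto simp: Z_def ad_def\<close>)
    have "\<exists>n. (ad y ^^ n) w0 \<in> U"
      using nil[of y w0] subspace_0[OF U] by metis
    define n where "n = (LEAST n. (ad y ^^ n) w0 \<in> U)"
    have n: "(ad y ^^ n) w0 \<in> U"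
      unfolding n_def using \<open>\<exists>n. (ad y ^^ n) w0 \<in> U\<close> by (rule LeastI_ex)
    then have "n \<noteq> 0"
      using w0 by (intro notI) simp
    then obtain m where m: "n = Suc m"
      by (cases n) auto
    define w where "w = (ad y ^^ m) w0"
    have "w \<notin> U"
      using not_less_Least[of m "\<lambda>n. (ad y ^^ n) w0 \<in> U"] m by (auto simp: w_def n_def)
    moreover have wZ: "w \<in> Z"
      by (simp add: w_def Zpow)
    moreover have yw: "bracket y w \<in> U"
      using n by (simp add: m w_def ad_def)
    moreover have "bracket x w \<in> U" if x: "x \<in> K" for x
    proof -
      obtain h k where h: "h \<in> H" "x = h + k *s y"
        using mem_span_insert_subspace[OF sH] x KH by blast
      then show ?thesis
        using yw wZ U by (simp add: Z_def bracket_add_left bracket_scale_left subspace_add subspace_scale)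
    qed
    ultimately show ?thesis
      by (auto simp: Z_def)
  qed
qed

text \<open>
  The ideals that can contain a term of the lower central series only when \<open>L\<close> is nilpotent are
  called good here. The zero ideal is good. If \<open>U \<noteq> L\<close> is good, the previous lemma gives \<open>w \<notin> U\<close>
  with \<open>[L, w] \<subseteq> U\<close>. Then \<open>[L, U + F w] \<subseteq> U\<close>, so that a term of the series inside \<open>U + F w\<close> is
  followed by one inside \<open>U\<close>, and \<open>U + F w\<close> is good too. A good ideal of largest dimension is
  therefore \<open>L\<close>, which contains the whole series.
\<close>

lemma engel:
  assumes fd: "finite_dimensional_vector_space scale B"
    and nil: "\<And>x y. \<exists>n. (ad x ^^ n) y = 0"
  shows nilpotent
proof -
  interpret fd: finite_dimensional_vector_space scale B
    by (rule fd)
  let ?good = "\<lambda>U. subspace U \<and> invariant UNIV U \<and>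
    ((\<exists>a. lower_central_series a \<subseteq> U) \<longrightarrow> nilpotent)"
  have lcs0: "0 \<in> lower_central_series a" for a
    by (cases a) (auto intro: span_zero)
  have "?good {0}"
  proof -
    have "nilpotent" if "lower_central_series a \<subseteq> {0}" for a
      unfolding nilpotent_def using that lcs0[of a] by (intro exI[of _ a]) blast
    then show ?thesis
      by (auto simp: invariant_def)
  qed
  moreover have "\<forall>U. ?good U \<longrightarrow> dim U < Suc (dim UNIV)"
    by (intro allI impI le_imp_less_Suc fd.dim_subset subset_UNIV)
  ultimately have "\<exists>U. ?good U \<and> (\<forall>U'. ?good U' \<longrightarrow> dim U' \<le> dim U)"
    by (rule ex_has_greatest_nat)
  then obtain U where UM: "?good U \<and> (\<forall>U'. ?good U' \<longrightarrow> dim U' \<le> dim U)"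
    by (rule exE)
  note U = UM[THEN conjunct1] and max = UM[THEN conjunct2]
  have sU: "subspace U"
    using U by blast
  have "U = UNIV"
  proof (rule ccontr)
    assume "U \<noteq> UNIV"
    then have "U \<subset> UNIV" by blast
    then obtain w where w: "w \<notin> U" "\<And>x. bracket x w \<in> U"
      using engel_common_vector[OF fd nil, of UNIV U UNIV] U
      by (auto simp: subalgebra_def invariant_def)
    define U' where "U' = span (insert w U)"
    have UU': "U \<subseteq> U'"
      by (auto simp: U'_def intro: span_base)
    have br: "bracket x u \<in> U" if "u \<in> U'" for x u
    proof -
      obtain h k where "h \<in> U" "u = h + k *s w"
        using mem_span_insert_subspace[OF sU] \<open>u \<in> U'\<close> U'_def by blast
      then show ?thesis
        using U w by (simp add: invariant_def bracket_add_right bracket_scale_right subspace_add subspace_scale)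
    qed
    have "nilpotent" if a: "lower_central_series a \<subseteq> U'" for a
    proof -
      have "lower_central_series (Suc a) \<subseteq> U"
        unfolding lower_central_series.simps
        by (rule span_minimal[OF _ sU]) (use a br in auto)
      then show ?thesis
        using U by blast
    qed
    then have "?good U'"
      using br UU' by (auto simp: U'_def invariant_def)
    then have "dim U' \<le> dim U"
      using max by blast
    then have "U = U'"
      using fd.subspace_dim_equal[OF sU _ UU'] by (simp add: U'_def)
    then show False
      using w(1) span_base[of w "insert w U"] by (auto simp: U'_def)
  qed
  then show ?thesis
    using U by (metis subset_UNIV)
qed

lemma nilpotent_imp_ad_nilpotent:
  assumes nilpotent
  shows "\<exists>n. \<forall>x y. (ad x ^^ n) y = 0"
proof -
  obtain n where n: "lower_central_series n = {0}"
    using assms by (auto simp: nilpotent_def)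
  have "(ad x ^^ k) y \<in> lower_central_series k" for x y k
    by (induction k) (auto simp: ad_def intro: span_base)
  with n show ?thesis
    by blast
qed

section \<open>The adjoint representation in coordinates\<close>

definition coords :: "nat \<Rightarrow> (nat \<Rightarrow> 'b) \<Rightarrow> 'b \<Rightarrow> 'a vec" where
  "coords s e w = vec s (\<lambda>k. representation (e ` {1..s}) w (e (Suc k)))"

lemma matrix_of_carrier [simp]: "matrix_of s e T \<in> carrier_mat s s"
  by (simp add: matrix_of_def)

lemma coords_carrier [simp]: "coords s e w \<in> carrier_vec s"
  by (simp add: coords_def)

context
  fixes s :: nat and e :: "nat \<Rightarrow> 'b"
  assumes basis: "is_basis s e"
begin

lemma basis_independent: "independent (e ` {1..s})"
  and basis_span: "span (e ` {1..s}) = UNIV"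
  and basis_inj: "inj_on e {1..s}"
  using basis by (auto simp: is_basis_def)

lemma finite_dimensional: "finite_dimensional_vector_space scale (e ` {1..s})"
  by unfold_locales (use basis in \<open>auto simp: is_basis_def\<close>)

lemma basis_expansion: "w = (\<Sum>l<s. representation (e ` {1..s}) w (e (Suc l)) *s e (Suc l))"
proof -
  have "w = (\<Sum>b\<in>e ` {1..s}. representation (e ` {1..s}) w b *s b)"
    by (rule sum_representation_eq[symmetric]) (auto simp: basis_independent basis_span simp del: One_nat_def)
  also have "\<dots> = (\<Sum>i\<in>{1..s}. representation (e ` {1..s}) w (e i) *s e i)"
    by (simp add: sum.reindex[OF basis_inj] del: One_nat_def)
  also have "\<dots> = (\<Sum>l<s. representation (e ` {1..s}) w (e (Suc l)) *s e (Suc l))"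
    by (simp add: sum.shift_bounds_cl_Suc_ivl sum.atLeast1_atMost_eq)
  finally show ?thesis .
qed

lemma coords_basis: "l < s \<Longrightarrow> k < s \<Longrightarrow>
    representation (e ` {1..s}) (e (Suc l)) (e (Suc k)) = (if k = l then 1 else 0)"
  using inj_onD[OF basis_inj, of "Suc k" "Suc l"]
  by (subst representation_basis[OF basis_independent]) auto

lemma representation_sum_scale:
  "representation (e ` {1..s}) (\<Sum>i\<in>I. c i *s u i) b =
    (\<Sum>i\<in>I. c i * representation (e ` {1..s}) (u i) b)"
  by (simp add: representation_sum[OF basis_independent] representation_scale[OF basis_independent]
      basis_span del: One_nat_def)

lemma coords_eq_0_iff: "coords s e w = 0\<^sub>v s \<longleftrightarrow> w = 0"
proof
  assume *: "coords s e w = 0\<^sub>v s"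
  have "representation (e ` {1..s}) w (e (Suc l)) = 0" if "l < s" for l
    using arg_cong[OF *, of "\<lambda>v. v $ l"] that by (simp add: coords_def)
  then show "w = 0"
    by (subst basis_expansion) simp
qed (auto simp: coords_def representation_zero simp del: One_nat_def)

lemma coords_surj:
  assumes "v \<in> carrier_vec s"
  obtains w where "coords s e w = v"
proof
  show "coords s e (\<Sum>l<s. v $ l *s e (Suc l)) = v"
    using assms by (intro eq_vecI) (auto simp: coords_def representation_sum_scale coords_basis
        if_distrib[of "(*) _"] simp del: One_nat_def cong: if_cong)
qed

lemma matrix_of_mult_coords:
  assumes "\<And>x y. T (x + y) = T x + T y" "\<And>c x. T (c *s x) = c *s T x"
  shows "matrix_of s e T *\<^sub>v coords s e w = coords s e (T w)"
proof (rule eq_vecI)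
  fix k assume "k < dim_vec (coords s e (T w))"
  then have k: "k < s"
    by (simp add: coords_def)
  let ?r = "representation (e ` {1..s})"
  have T0: "T 0 = 0"
    using assms(2)[of 0 0] by simp
  have Tsum: "T (\<Sum>i\<in>I. f i) = (\<Sum>i\<in>I. T (f i))" for f :: "nat \<Rightarrow> 'b" and I
    by (induction I rule: infinite_finite_induct) (auto simp: assms T0)
  have "T w = T (\<Sum>l<s. ?r w (e (Suc l)) *s e (Suc l))"
    by (subst basis_expansion[of w]) simp
  also have "\<dots> = (\<Sum>l<s. ?r w (e (Suc l)) *s T (e (Suc l)))"
    by (simp add: Tsum assms)
  finally have "?r (T w) (e (Suc k)) = (\<Sum>l<s. ?r w (e (Suc l)) * ?r (T (e (Suc l))) (e (Suc k)))"
    by (simp add: representation_sum_scale del: One_nat_def)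
  then show "(matrix_of s e T *\<^sub>v coords s e w) $ k = coords s e (T w) $ k"
    using k by (auto simp: coords_def matrix_of_def scalar_prod_def lessThan_atLeast0 mult.commute
        intro!: sum.cong)
qed (simp add: coords_def matrix_of_def)

lemma matrix_of_ad_pow_coords:
  "matrix_of s e (ad x) ^\<^sub>m n *\<^sub>v coords s e w = coords s e ((ad x ^^ n) w)"
proof (induction n arbitrary: w)
  case 0
  show ?case
    by (simp add: matrix_of_def coords_def)
next
  case (Suc n)
  let ?A = "matrix_of s e (ad x)"
  have "?A ^\<^sub>m Suc n *\<^sub>v coords s e w = ?A ^\<^sub>m n *\<^sub>v (?A *\<^sub>v coords s e w)"
    by (simp add: assoc_mult_mat_vec[of _ s s _ s])
  also have "?A *\<^sub>v coords s e w = coords s e (ad x w)"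
    by (rule matrix_of_mult_coords) (auto simp: ad_def bracket_add_right bracket_scale_right)
  also have "?A ^\<^sub>m n *\<^sub>v coords s e (ad x w) = coords s e ((ad x ^^ n) (ad x w))"
    by (rule Suc.IH)
  finally show ?case
    by (simp add: funpow_swap1)
qed

lemma eigenvalue_matrix_of_ad_nilpotent:
  assumes "\<And>y. (ad x ^^ n) y = 0" and "eigenvalue (matrix_of s e (ad x)) k"
  shows "k = 0"
proof -
  let ?A = "matrix_of s e (ad x)"
  obtain v where v: "eigenvector ?A v k"
    using assms(2) by (auto simp: eigenvalue_def)
  have dim: "dim_row ?A = s"
    by (simp add: matrix_of_def)
  have v': "v \<in> carrier_vec s" "v \<noteq> 0\<^sub>v s"
    using v by (auto simp: eigenvector_def dim)
  obtain w where w: "coords s e w = v"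
    using coords_surj[OF v'(1)] .
  have "k ^ n \<cdot>\<^sub>v v = ?A ^\<^sub>m n *\<^sub>v v"
    by (rule eigenvector_pow[OF matrix_of_carrier v, symmetric])
  also have "\<dots> = 0\<^sub>v s"
    unfolding w[symmetric] matrix_of_ad_pow_coords assms(1) by (simp add: coords_eq_0_iff)
  finally have eq: "k ^ n \<cdot>\<^sub>v v = 0\<^sub>v s" .
  obtain i where i: "i < s" "v $ i \<noteq> 0"
  proof (rule ccontr)
    assume "\<not> thesis"
    with that have "v $ i = 0" if "i < s" for i
      using \<open>i < s\<close> by blast
    then have "v = 0\<^sub>v s"
      using v'(1) by (intro eq_vecI) auto
    with v'(2) show False by simp
  qed
  have "k ^ n * v $ i = 0"
    using arg_cong[OF eq, of "\<lambda>v. v $ i"] i v'(1) by simp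
  then show ?thesis
    using i by simp
qed

text \<open>
  The determinant in \<open>p_ad\<close> has \<open>z\<^sub>0 I + \<dots>\<close>, whereas a characteristic polynomial has \<open>X I - \<dots>\<close>;
  hence the minus sign in front of the linear combination.
\<close>

lemma eval_p_ad:
  "eval_mpoly v (p_ad s e) =
    poly (char_poly (matrix_of s e (ad (- (\<Sum>i=1..s. v i *s e i))))) (v 0)"
proof -
  interpret ev: comm_ring_hom "eval_mpoly v"
    by (rule eval_mpoly_hom)
  let ?r = "representation (e ` {1..s})"
  let ?x = "- (\<Sum>i=1..s. v i *s e i)"
  let ?A = "matrix_of s e (ad ?x)"
  have brsum: "bracket (\<Sum>i\<in>I. v i *s e i) y = (\<Sum>i\<in>I. v i *s bracket (e i) y)" for I y
    by (induction I rule: infinite_finite_induct) (auto simp: bracket_add_left bracket_scale_left)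
  have adx: "ad ?x y = (\<Sum>i=1..s. (- v i) *s bracket (e i) y)" for y
    using bracket_scale_left[of "-1" "\<Sum>i=1..s. v i *s e i" y]
    by (simp add: ad_def brsum sum_negf)
  have "eval_mpoly v (p_ad s e) = det (map_mat (eval_mpoly v) (mat s s (\<lambda>(k, l).
     indet 0 * const_mpoly (matrix_of s e id $$ (k, l)) +
     (\<Sum>i = 1..s. indet i * const_mpoly (matrix_of s e (ad (e i)) $$ (k, l))))))"
    unfolding p_ad_def by simp
  also have "map_mat (eval_mpoly v) (mat s s (\<lambda>(k, l).
     indet 0 * const_mpoly (matrix_of s e id $$ (k, l)) +
     (\<Sum>i = 1..s. indet i * const_mpoly (matrix_of s e (ad (e i)) $$ (k, l))))) =
     - char_matrix ?A (v 0)"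
  proof (rule eq_matI)
    fix k l assume "k < dim_row (- char_matrix ?A (v 0))" "l < dim_col (- char_matrix ?A (v 0))"
    then have kl: "k < s" "l < s"
      by (auto simp: char_matrix_def matrix_of_def)
    have "?A $$ (k, l) = - (\<Sum>i=1..s. v i * ?r (bracket (e i) (e (Suc l))) (e (Suc k)))"
      using kl by (simp add: matrix_of_def adx representation_sum_scale sum_negf del: scale_minus_left One_nat_def)
    then show "map_mat (eval_mpoly v) (mat s s (\<lambda>(k, l).
     indet 0 * const_mpoly (matrix_of s e id $$ (k, l)) +
     (\<Sum>i = 1..s. indet i * const_mpoly (matrix_of s e (ad (e i)) $$ (k, l))))) $$ (k, l) =
     (- char_matrix ?A (v 0)) $$ (k, l)"
      using kl
      by (simp add: char_matrix_def eval_mpoly_add eval_mpoly_mult eval_mpoly_sum del: One_nat_def)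
        (simp add: matrix_of_def coords_basis ad_def del: One_nat_def)
  qed (auto simp: char_matrix_def matrix_of_def)
  also have "det (- char_matrix ?A (v 0)) = poly (char_poly ?A) (v 0)"
    by (rule char_poly_matrix[OF matrix_of_carrier, symmetric])
  finally show ?thesis .
qed

end

end

theorem theorem4p8:
  fixes scale :: "'a::{alg_closed_field, field_char_0} \<Rightarrow> 'b::ab_group_add \<Rightarrow> 'b"
    and bracket :: "'b \<Rightarrow> 'b \<Rightarrow> 'b"
    and s :: nat
    and e :: "nat \<Rightarrow> 'b"
  assumes "lie_algebra scale bracket"
    and "lie_algebra.is_basis scale s e"
  shows "lie_algebra.nilpotent scale bracket \<longleftrightarrow>
    lie_algebra.p_ad scale bracket s e = indet 0 ^ s"
proof -
  interpret lie_algebra scale bracket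
    by (rule assms(1))
  note basis = assms(2)
  have eval_pow: "eval_mpoly v (indet 0 ^ s) = v 0 ^ s" for v :: "nat \<Rightarrow> 'a"
  proof -
    interpret ev: comm_ring_hom "eval_mpoly v"
      by (rule eval_mpoly_hom)
    show ?thesis
      by (simp add: ev.hom_power)
  qed
  show ?thesis
  proof
    assume nilpotent
    then obtain n where n: "\<And>x y. (ad x ^^ n) y = 0"
      using nilpotent_imp_ad_nilpotent by blast
    show "p_ad s e = indet 0 ^ s"
    proof (rule eval_mpoly_inject)
      fix v
      let ?A = "matrix_of s e (ad (- (\<Sum>i=1..s. scale (v i) (e i))))"
      have "char_poly ?A = monom 1 s"
        by (rule char_poly_eq_monom_if_eigenvalues_zero[OF matrix_of_carrier])
          (rule eigenvalue_matrix_of_ad_nilpotent[OF basis n])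
      then show "eval_mpoly v (p_ad s e) = eval_mpoly v (indet 0 ^ s)"
        by (simp add: eval_p_ad[OF basis] eval_pow poly_monom)
    qed
  next
    assume p: "p_ad s e = indet 0 ^ s"
    have "(ad x ^^ s) y = 0" for x y
    proof -
      let ?r = "representation (e ` {1..s})"
      \<comment> \<open>The point has the coordinates of \<open>- x\<close>, since evaluation at it gives the matrix of
        the negated combination.\<close>
      have x: "x = - (\<Sum>i=1..s. scale (?r (- x) (e i)) (e i))"
        using basis_expansion[OF basis, of "- x"]
        by (simp add: sum.atLeast1_atMost_eq)
      have "poly (char_poly (matrix_of s e (ad x))) c = poly (monom 1 s) c" for c
      proof -
        define v where "v i = (if i = 0 then c else ?r (- x) (e i))" for i
        have "(\<Sum>i=1..s. scale (v i) (e i)) = (\<Sum>i=1..s. scale (?r (- x) (e i)) (e i))"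
          by (rule sum.cong) (auto simp: v_def)
        with x have "- (\<Sum>i=1..s. scale (v i) (e i)) = x"
          by simp
        then show ?thesis
          using eval_p_ad[OF basis, of v] by (simp add: p eval_pow poly_monom v_def)
      qed
      then have "char_poly (matrix_of s e (ad x)) = monom 1 s"
        by (simp add: poly_eq_poly_eq_iff[symmetric] fun_eq_iff)
      then have "matrix_of s e (ad x) ^\<^sub>m s = 0\<^sub>m s s"
        by (rule char_poly_monom_imp_nilpotent[OF matrix_of_carrier])
      then have "coords s e ((ad x ^^ s) y) = 0\<^sub>m s s *\<^sub>v coords s e y"
        using matrix_of_ad_pow_coords[OF basis, of x s y] by simp
      also have "\<dots> = 0\<^sub>v s"
        by (rule eq_vecI) (auto simp: coords_def)
      finally have "coords s e ((ad x ^^ s) y) = 0\<^sub>v s" .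
      then show ?thesis
        by (simp add: coords_eq_0_iff[OF basis])
    qed
    then show nilpotent
      by (intro engel[OF finite_dimensional[OF basis]]) blast
  qed
qed

end
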